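(* Suppose preferences follow the Bradley–Terry model with utility $U$: $P(y_w\succ y_\ell\mid x)=\sigma\big(U(x,y_w)-U(x,y_\ell)\big)$, where $\sigma(z)=1/(1+e^{-z})$. Then the optimal policy $\pi_\theta^*$ learned by DPO with these utility-based preferences satisfies $$\pi_\theta^*(y\mid x)\;\propto\;\pi_{\mathrm{ref}}(y\mid x)\exp\!\left(\frac{U(x,y)}{\beta}\right)$$ (proportionality in $y$ for each fixed $x$), which is the entropy-regularized utility-maximizing policy.
   Context: For each problem $x$ there are chains (responses) $y_1,\dots,y_K$ and a real-valued utility $U(x,y)$. $\pi_{\mathrm{ref}}(\cdot\mid x)$ is a fixed reference policy (conditional distribution over chains), $\beta>0$ a regularization constant, and $\pi_\theta(\cdot\mid x)$ the policy being learned. The implicit reward is $r_\theta(x,y)=\beta\,[\log\pi_\theta(y\mid x)-\log\pi_{\mathrm{ref}}(y\mid x)]$. For a preference pair in which $y_w$ is preferred to $y_\ell$ on problem $x$, the DPO loss is $$\mathcal{L}_{\mathrm{DPO}}(x;y_w,y_\ell)=-\log\sigma\big(r_\theta(x,y_w)-r_\theta(x,y_\ell)\big),$$ and the DPO objective is the expectation of this loss over the distribution of preference pairs, where for a compared pair of chains the winner is determined at random with the stated Bradley–Terry probabilities. The optimal policy $\pi_\theta^*$ is the policy attaining the global minimum of the DPO objective. "Entropy-regularized utility-maximizing policy" means the maximizer over policies $\pi(\cdot\mid x)$ of $\mathbb{E}_{y\sim\pi(\cdot\mid x)}[U(x,y)]-\beta\,\mathrm{KL}\big(\pi(\cdot\mid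 x)\,\|\,\pi_{\mathrm{ref}}(\cdot\mid x)\big)$.
   Formalization: Added assumption: the distribution of preference pairs is discrete and, for each problem, the graph of chains compared with positive probability is connected; otherwise the DPO minimum is also attained by policies not of the stated form. *)

theory Defs
  imports "HOL-Probability.Probability"
begin

text \<open>
  A policy is a map \<open>\<pi> :: 'x \<Rightarrow> 'y pmf\<close>, and \<open>pmf (\<pi> x) y\<close> is the probability of the chain \<open>y\<close>
  on the problem \<open>x\<close>. \<open>Y x\<close> is the finite set of chains of \<open>x\<close>.
\<close>

definition sigmoid :: "real \<Rightarrow> real" where
  "sigmoid z = 1 / (1 + exp (- z))"

definition implicit_reward ::
  "real \<Rightarrow> ('x \<Rightarrow> 'y pmf) \<Rightarrow> ('x \<Rightarrow> 'y pmf) \<Rightarrow> 'x \<Rightarrow> 'y \<Rightarrow> real" where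
  "implicit_reward \<beta> \<pi>ref \<pi> x y = \<beta> * (ln (pmf (\<pi> x) y) - ln (pmf (\<pi>ref x) y))"

definition dpo_loss ::
  "real \<Rightarrow> ('x \<Rightarrow> 'y pmf) \<Rightarrow> ('x \<Rightarrow> 'y pmf) \<Rightarrow> 'x \<Rightarrow> 'y \<Rightarrow> 'y \<Rightarrow> real" where
  "dpo_loss \<beta> \<pi>ref \<pi> x yw yl =
     - ln (sigmoid (implicit_reward \<beta> \<pi>ref \<pi> x yw - implicit_reward \<beta> \<pi>ref \<pi> x yl))"

text \<open>
  \<open>D\<close> is the distribution of the compared triples \<open>(x, a, b)\<close>, whose order of \<open>a\<close> and \<open>b\<close> carries
  no preference, and \<open>P x a b\<close> is the probability that \<open>a\<close> is preferred to \<open>b\<close>. The result is the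
  distribution of the triples \<open>(x, winner, loser)\<close>.
\<close>

definition preference_pairs ::
  "('x \<times> 'y \<times> 'y) pmf \<Rightarrow> ('x \<Rightarrow> 'y \<Rightarrow> 'y \<Rightarrow> real) \<Rightarrow> ('x \<times> 'y \<times> 'y) pmf" where
  "preference_pairs D P =
     bind_pmf D (\<lambda>(x, a, b).
       map_pmf (\<lambda>a_wins. if a_wins then (x, a, b) else (x, b, a)) (bernoulli_pmf (P x a b)))"

text \<open>
  The loss is nonnegative, so its expectation exists in \<open>ennreal\<close>; the Bochner integral would
  assign the value 0 to a policy of infinite expected loss.
\<close>

definition dpo_objective ::
  "real \<Rightarrow> ('x \<Rightarrow> 'y pmf) \<Rightarrow> ('x \<times> 'y \<times> 'y) pmf \<Rightarrow> ('x \<Rightarrow> 'y \<Rightarrow> 'y \<Rightarrow> real) \<Rightarrow>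
     ('x \<Rightarrow> 'y pmf) \<Rightarrow> ennreal" where
  "dpo_objective \<beta> \<pi>ref D P \<pi> =
     (\<integral>\<^sup>+ (x, yw, yl). ennreal (dpo_loss \<beta> \<pi>ref \<pi> x yw yl) \<partial>measure_pmf (preference_pairs D P))"

text \<open>
  The implicit reward takes the logarithm of every chain probability, and \<open>ln 0 = 0\<close> in HOL.
  The DPO objective is therefore minimized over the policies for which all these logarithms are
  genuine, that is, those giving every chain positive probability.
\<close>

definition positive_policy :: "'x set \<Rightarrow> ('x \<Rightarrow> 'y set) \<Rightarrow> ('x \<Rightarrow> 'y pmf) \<Rightarrow> bool" where
  "positive_policy X Y \<pi> \<longleftrightarrow> (\<forall>x\<in>X. set_pmf (\<pi> x) = Y x)"

definition dpo_optimal ::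
  "real \<Rightarrow> ('x \<Rightarrow> 'y pmf) \<Rightarrow> ('x \<times> 'y \<times> 'y) pmf \<Rightarrow> ('x \<Rightarrow> 'y \<Rightarrow> 'y \<Rightarrow> real) \<Rightarrow>
     'x set \<Rightarrow> ('x \<Rightarrow> 'y set) \<Rightarrow> ('x \<Rightarrow> 'y pmf) \<Rightarrow> bool" where
  "dpo_optimal \<beta> \<pi>ref D P X Y \<pi> \<longleftrightarrow>
     is_arg_min (dpo_objective \<beta> \<pi>ref D P) (positive_policy X Y) \<pi>"

text \<open>The pairs of chains of \<open>x\<close> that are compared with positive probability, in either order.\<close>

definition compared :: "('x \<times> 'y \<times> 'y) pmf \<Rightarrow> 'x \<Rightarrow> ('y \<times> 'y) set" where
  "compared D x = {(a, b). (x, a, b) \<in> set_pmf D \<or> (x, b, a) \<in> set_pmf D}"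

text \<open>
  \<open>KL_divergence b M N\<close> is the divergence of \<open>N\<close> from \<open>M\<close>, so the reference measure comes first;
  the base \<open>exp 1\<close> gives the natural logarithm. Policies that vanish on some chains are allowed here.
\<close>

definition regularized_utility ::
  "real \<Rightarrow> ('x \<Rightarrow> 'y pmf) \<Rightarrow> ('x \<Rightarrow> 'y \<Rightarrow> real) \<Rightarrow> 'x \<Rightarrow> 'y pmf \<Rightarrow> real" where
  "regularized_utility \<beta> \<pi>ref U x p =
     measure_pmf.expectation p (U x)
       - \<beta> * KL_divergence (exp 1) (measure_pmf (\<pi>ref x)) (measure_pmf p)"

definition entropy_regularized_optimal ::
  "real \<Rightarrow> ('x \<Rightarrow> 'y pmf) \<Rightarrow> ('x \<Rightarrow> 'y \<Rightarrow> real) \<Rightarrow> ('x \<Rightarrow> 'y set) \<Rightarrow> 'x \<Rightarrow> 'y pmf \<Rightarrow> bool" where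
  "entropy_regularized_optimal \<beta> \<pi>ref U Y x p \<longleftrightarrow>
     is_arg_max (regularized_utility \<beta> \<pi>ref U x) (\<lambda>q. set_pmf q \<subseteq> Y x) p"

end

theory Submission
  imports Defs
begin

text \<open>
  Given a compared pair with utility difference \<open>d\<close>, a policy with reward difference \<open>t\<close> incurs the
  cross entropy of the Bernoulli distributions with parameters \<open>\<sigma> d\<close> and \<open>\<sigma> t\<close> as expected loss,
  which is minimal exactly for \<open>t = d\<close>. The Gibbs policy has \<open>t = d\<close> on every pair, with finite
  total loss, so a minimizer must agree with it on every compared pair; as the comparison graph on
  the chains of a problem is connected, its reward equals the utility up to a constant. Moreover the
  regularized utility of \<open>q\<close> is a constant minus \<open>\<beta>\<close> times the divergence of \<open>q\<close> from the
  Gibbs policy. Both optimizations thus rest on the same inequality \<open>x ln (x / y) \<ge> x - y\<close>.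
\<close>

section \<open>Gibbs' inequality on a finite set\<close>

text \<open>Multiply \<open>ln z \<le> z - 1\<close> at \<open>z = y / x\<close> by
  \<open>x\<close>; equality there forces \<open>z = 1\<close>. At \<open>x = 0\<close> the left
  side is \<open>- y < 0\<close>, so equality cannot occur.\<close>

lemma diff_le_mult_ln_divide:
  fixes x y :: real
  assumes "x \<ge> 0" "y > 0"
  shows "x - y \<le> x * ln (x / y)"
    and "x * ln (x / y) = x - y \<Longrightarrow> x = y"
proof -
  show "x - y \<le> x * ln (x / y)"
  proof (cases "x = 0")
    case False
    then have "x > 0" using assms by simp
    then have "ln (y / x) \<le> y / x - 1" using assms by (intro ln_le_minus_one) simp
    then have "x * ln (y / x) \<le> x * (y / x - 1)" using \<open>x > 0\<close> by simp
    also have "\<dots> = y - x" using \<open>x > 0\<close> by (simp add: field_simps)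
    finally show ?thesis using \<open>x > 0\<close> assms by (simp add: ln_div algebra_simps)
  qed (use assms in simp)
  show "x = y" if eq: "x * ln (x / y) = x - y"
  proof (cases "x = 0")
    case False
    then have "x > 0" using assms by simp
    then have "x * ln (y / x) = x * (y / x - 1)"
      using eq assms by (simp add: ln_div algebra_simps)
    then have "ln (y / x) = y / x - 1" using \<open>x > 0\<close> by simp
    then have "y / x = 1" using \<open>x > 0\<close> assms by (intro ln_eq_minus_one) simp_all
    then show ?thesis using \<open>x > 0\<close> by simp
  qed (use assms eq in simp)
qed

lemma gibbs_inequality:
  fixes p q :: "'a \<Rightarrow> real"
  assumes "finite A" "\<And>a. a \<in> A \<Longrightarrow> p a \<ge> 0" "\<And>a. a \<in> A \<Longrightarrow> q a > 0" "sum p A = sum q A"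
  shows "0 \<le> (\<Sum>a\<in>A. p a * ln (p a / q a))"
    and "(\<Sum>a\<in>A. p a * ln (p a / q a)) = 0 \<Longrightarrow> a \<in> A \<Longrightarrow> p a = q a"
proof -
  let ?g = "\<lambda>a. p a * ln (p a / q a) - (p a - q a)"
  have nonneg: "0 \<le> ?g a" if "a \<in> A" for a
    using diff_le_mult_ln_divide(1)[of "p a" "q a"] assms that by simp
  have sum: "sum ?g A = (\<Sum>a\<in>A. p a * ln (p a / q a))"
    using assms(4) by (simp add: sum_subtractf)
  show "0 \<le> (\<Sum>a\<in>A. p a * ln (p a / q a))"
    unfolding sum[symmetric] using nonneg by (rule sum_nonneg)
  assume "(\<Sum>a\<in>A. p a * ln (p a / q a)) = 0" "a \<in> A"
  then have "?g a = 0"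
    using sum_nonneg_eq_0_iff[OF assms(1), of ?g] nonneg sum by simp
  then show "p a = q a"
    using diff_le_mult_ln_divide(2)[of "p a" "q a"] assms \<open>a \<in> A\<close> by simp
qed

section \<open>The sigmoid and the Bernoulli cross entropy\<close>

lemma sigmoid_pos: "sigmoid z > 0"
  by (simp add: sigmoid_def add_pos_pos)

lemma sigmoid_less_1: "sigmoid z < 1"
  by (simp add: sigmoid_def add_pos_pos)

lemma sigmoid_minus: "sigmoid (- z) = 1 - sigmoid z"
proof -
  have "1 + exp z \<noteq> 0" "1 + exp (- z) \<noteq> 0"
    using add_pos_pos[OF zero_less_one exp_gt_zero] by (metis less_irrefl)+
  then show ?thesis by (simp add: sigmoid_def exp_minus field_simps)
qed

lemma sigmoid_eq_iff: "sigmoid s = sigmoid t \<longleftrightarrow> s = t"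
proof -
  have "1 + exp (- z) \<noteq> 0" for z :: real
    using add_pos_pos[OF zero_less_one exp_gt_zero] by (metis less_irrefl)
  then show ?thesis by (simp add: sigmoid_def)
qed

text \<open>The complementary probabilities are written \<open>sigmoid (- d)\<close> and
  \<open>sigmoid (- t)\<close> because exchanging the two chains negates both differences.\<close>

definition bernoulli_loss :: "real \<Rightarrow> real \<Rightarrow> real" where
  "bernoulli_loss d t = sigmoid d * - ln (sigmoid t) + sigmoid (- d) * - ln (sigmoid (- t))"

lemma bernoulli_loss_nonneg: "bernoulli_loss d t \<ge> 0"
  unfolding bernoulli_loss_def
  by (intro add_nonneg_nonneg mult_nonneg_nonneg)
    (simp_all add: sigmoid_pos less_imp_le[OF sigmoid_pos] less_imp_le[OF sigmoid_less_1])

text \<open>Cross entropy minus entropy is relative entropy, written as a sum over the two outcomes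
  to fit \<open>gibbs_inequality\<close>.\<close>

lemma bernoulli_loss_diff:
  "bernoulli_loss d t - bernoulli_loss d d =
     (\<Sum>s\<in>{True, False}. sigmoid (if s then d else - d) *
        ln (sigmoid (if s then d else - d) / sigmoid (if s then t else - t)))"
  by (simp add: bernoulli_loss_def ln_div sigmoid_pos less_imp_neq[OF sigmoid_pos, THEN not_sym]
      algebra_simps)

lemma bernoulli_loss_minimal:
  shows "bernoulli_loss d d \<le> bernoulli_loss d t"
    and "bernoulli_loss d t = bernoulli_loss d d \<Longrightarrow> t = d"
proof -
  let ?p = "\<lambda>z s. sigmoid (if s then z else - z)"
  have nonneg: "?p d s \<ge> 0" for s
    by (simp add: less_imp_le[OF sigmoid_pos])
  have total: "sum (?p d) {True, False} = sum (?p t) {True, False}"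
    by (simp add: sigmoid_minus)
  show "bernoulli_loss d d \<le> bernoulli_loss d t"
    using gibbs_inequality(1)[of "{True, False}" "?p d" "?p t", OF _ nonneg sigmoid_pos total]
      bernoulli_loss_diff[of d t] by simp
  assume "bernoulli_loss d t = bernoulli_loss d d"
  then have "?p d True = ?p t True"
    using gibbs_inequality(2)[of "{True, False}" "?p d" "?p t" True, OF _ nonneg sigmoid_pos total]
      bernoulli_loss_diff[of d t] by simp
  then show "t = d"
    by (simp add: sigmoid_eq_iff)
qed

text \<open>The fair-coin prediction \<open>t = 0\<close> costs \<open>ln 2\<close> for every
  \<open>d\<close>, and the best prediction costs no more. This uniform bound later makes the
  optimal objective finite.\<close>

lemma bernoulli_loss_bounded: "bernoulli_loss d d \<le> ln 2"
proof -
  have "bernoulli_loss d 0 = (sigmoid d + sigmoid (- d)) * ln 2"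
    by (simp add: bernoulli_loss_def sigmoid_def ln_div distrib_right)
  then show ?thesis
    using bernoulli_loss_minimal(1)[of d 0] by (simp add: sigmoid_minus)
qed

section \<open>The DPO objective as an expected cross entropy\<close>

text \<open>Conditioned on a compared triple, only the winner is random; averaging the losses of the
  two orders with the Bradley-Terry weights gives the cross entropy.\<close>

lemma dpo_objective_bradley_terry:
  assumes "\<And>x a b. (x, a, b) \<in> set_pmf D \<Longrightarrow> P x a b = sigmoid (U x a - U x b)"
  shows "dpo_objective \<beta> \<pi>ref D P \<pi> =
    (\<integral>\<^sup>+ (x, a, b). ennreal (bernoulli_loss (U x a - U x b)
       (implicit_reward \<beta> \<pi>ref \<pi> x a - implicit_reward \<beta> \<pi>ref \<pi> x b)) \<partial>measure_pmf D)"
proof -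
  let ?L = "\<lambda>(x, a, b). ennreal (dpo_loss \<beta> \<pi>ref \<pi> x a b)"
  have nonneg: "dpo_loss \<beta> \<pi>ref \<pi> x a b \<ge> 0" for x a b
    by (simp add: dpo_loss_def sigmoid_pos less_imp_le[OF sigmoid_less_1])
  have "dpo_objective \<beta> \<pi>ref D P \<pi> =
    (\<integral>\<^sup>+ z. (\<integral>\<^sup>+ w. ?L w \<partial>measure_pmf (case z of (x, a, b) \<Rightarrow>
       map_pmf (\<lambda>s. if s then (x, a, b) else (x, b, a)) (bernoulli_pmf (P x a b)))) \<partial>measure_pmf D)"
    unfolding dpo_objective_def preference_pairs_def by (simp add: nn_integral_bind_pmf)
  also have "\<dots> = (\<integral>\<^sup>+ (x, a, b). ennreal (bernoulli_loss (U x a - U x b)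
       (implicit_reward \<beta> \<pi>ref \<pi> x a - implicit_reward \<beta> \<pi>ref \<pi> x b)) \<partial>measure_pmf D)"
  proof (intro nn_integral_cong_AE AE_pmfI)
    fix z assume z: "z \<in> set_pmf D"
    obtain x a b where zeq: "z = (x, a, b)" by (cases z)
    let ?p = "sigmoid (U x a - U x b)"
    let ?t = "implicit_reward \<beta> \<pi>ref \<pi> x a - implicit_reward \<beta> \<pi>ref \<pi> x b"
    \<comment> \<open>\<open>bernoulli_pmf\<close> clips its parameter to the unit interval; these
      bounds ensure that nothing is clipped.\<close>
    have p: "P x a b = ?p" "0 \<le> ?p" "?p \<le> 1"
      using assms z zeq by (simp_all add: less_imp_le[OF sigmoid_pos] less_imp_le[OF sigmoid_less_1])
    have "(\<integral>\<^sup>+ w. ?L w \<partial>measure_pmf (map_pmf (\<lambda>s. if s then (x, a, b) else (x, b, a))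
             (bernoulli_pmf (P x a b))))
        = ennreal ?p * ennreal (dpo_loss \<beta> \<pi>ref \<pi> x a b)
          + ennreal (1 - ?p) * ennreal (dpo_loss \<beta> \<pi>ref \<pi> x b a)"
      using p by (simp add: nn_integral_bernoulli_pmf mult.commute)
    also have "\<dots> = ennreal (?p * dpo_loss \<beta> \<pi>ref \<pi> x a b + (1 - ?p) * dpo_loss \<beta> \<pi>ref \<pi> x b a)"
      using p nonneg by (simp add: ennreal_mult ennreal_plus)
    also have "?p * dpo_loss \<beta> \<pi>ref \<pi> x a b + (1 - ?p) * dpo_loss \<beta> \<pi>ref \<pi> x b a
        = bernoulli_loss (U x a - U x b) ?t"
      \<comment> \<open>\<open>sigmoid_minus\<close> is instantiated at the utility difference only.
        At the reward difference the minus sign stays, and \<open>minus_diff_eq\<close> turns it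
        into the swapped pair.\<close>
      unfolding bernoulli_loss_def dpo_loss_def sigmoid_minus[of "U x a - U x b"]
      by (simp only: minus_diff_eq)
    finally show "(\<integral>\<^sup>+ w. ?L w \<partial>measure_pmf (case z of (x, a, b) \<Rightarrow>
         map_pmf (\<lambda>s. if s then (x, a, b) else (x, b, a)) (bernoulli_pmf (P x a b))))
      = (case z of (x, a, b) \<Rightarrow> ennreal (bernoulli_loss (U x a - U x b)
           (implicit_reward \<beta> \<pi>ref \<pi> x a - implicit_reward \<beta> \<pi>ref \<pi> x b)))"
      by (simp add: zeq)
  qed
  finally show ?thesis .
qed

section \<open>Gibbs policies and their implicit rewards\<close>

lemma exists_pmf_proportional:
  fixes w :: "'a \<Rightarrow> real"
  assumes "finite A" "A \<noteq> {}" "\<And>a. a \<in> A \<Longrightarrow> w a > 0" "\<And>a. a \<notin> A \<Longrightarrow> w a = 0"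
  obtains p c where "c > 0" "\<And>a. pmf p a = c * w a"
proof -
  \<comment> \<open>The reciprocal of the partition function.\<close>
  define c where "c = 1 / sum w A"
  have s: "sum w A > 0" using assms by (intro sum_pos) auto
  then have "c > 0" by (simp add: c_def)
  have nonneg: "0 \<le> c * w a" for a
    using assms(3,4)[of a] \<open>c > 0\<close> by (cases "a \<in> A") (simp_all add: less_imp_le)
  have "(\<integral>\<^sup>+ a. ennreal (c * w a) \<partial>count_space UNIV) = (\<Sum>a\<in>A. ennreal (c * w a))"
    using assms by (intro nn_integral_count_space'[OF assms(1)]) auto
  also have "\<dots> = ennreal (\<Sum>a\<in>A. c * w a)"
    using nonneg by (simp add: sum_ennreal)
  also have "(\<Sum>a\<in>A. c * w a) = 1"
    using s by (simp add: sum_divide_distrib[symmetric] c_def)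
  finally have "pmf (embed_pmf (\<lambda>a. c * w a)) a = c * w a" for a
    using nonneg by (intro pmf_embed_pmf) simp_all
  with \<open>c > 0\<close> show thesis by (rule that)
qed

lemma set_pmf_proportional:
  assumes "c > 0" "\<And>y. pmf p y = c * (pmf r y * exp (u y))"
  shows "set_pmf p = set_pmf r"
  using assms by (auto simp: set_pmf_iff)

text \<open>The logarithm cancels the reference probability and turns the normalizing factor into an
  additive constant, which drops out of reward differences.\<close>

lemma implicit_reward_gibbs:
  assumes "\<beta> > 0" "c > 0" "\<And>y. pmf (\<pi> x) y = c * (pmf (\<pi>ref x) y * exp (U x y / \<beta>))"
    and "y \<in> set_pmf (\<pi>ref x)"
  shows "implicit_reward \<beta> \<pi>ref \<pi> x y = \<beta> * ln c + U x y"
proof -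
  have "pmf (\<pi>ref x) y > 0" using assms(4) by (simp add: pmf_positive)
  then have "ln (pmf (\<pi> x) y) = ln c + (ln (pmf (\<pi>ref x) y) + U x y / \<beta>)"
    using assms(2) by (simp add: assms(3) ln_mult)
  then show ?thesis
    using assms(1) by (simp add: implicit_reward_def algebra_simps)
qed

text \<open>Converse direction: reward differences fix the logarithm of the policy relative to the
  reference up to a constant, and exponentiating makes that constant a factor.\<close>

lemma gibbs_of_implicit_reward:
  assumes "\<beta> > 0" "set_pmf (\<pi> x) = set_pmf (\<pi>ref x)"
    and "\<And>a b. a \<in> set_pmf (\<pi>ref x) \<Longrightarrow> b \<in> set_pmf (\<pi>ref x) \<Longrightarrow>
      implicit_reward \<beta> \<pi>ref \<pi> x a - implicit_reward \<beta> \<pi>ref \<pi> x b = U x a - U x b"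
  shows "\<exists>c>0. \<forall>y. pmf (\<pi> x) y = c * (pmf (\<pi>ref x) y * exp (U x y / \<beta>))"
proof -
  obtain b where b: "b \<in> set_pmf (\<pi>ref x)" using set_pmf_not_empty by fast
  \<comment> \<open>The excess of reward over utility is the same at all chains of the support, so
    it may be read off at \<open>b\<close>; \<open>exp k\<close> becomes the proportionality
    factor.\<close>
  define k where "k = (implicit_reward \<beta> \<pi>ref \<pi> x b - U x b) / \<beta>"
  have "pmf (\<pi> x) y = exp k * (pmf (\<pi>ref x) y * exp (U x y / \<beta>))" for y
  proof (cases "y \<in> set_pmf (\<pi>ref x)")
    case True
    then have pos: "pmf (\<pi>ref x) y > 0" "pmf (\<pi> x) y > 0"
      using assms(2) by (simp_all add: pmf_positive)
    have "implicit_reward \<beta> \<pi>ref \<pi> x y = \<beta> * k + U x y"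
      using assms(3)[OF True b] assms(1) by (simp add: k_def)
    then have "ln (pmf (\<pi> x) y) = k + (ln (pmf (\<pi>ref x) y) + U x y / \<beta>)"
      using assms(1) by (simp add: implicit_reward_def field_simps)
    then have "exp (ln (pmf (\<pi> x) y)) = exp (k + (ln (pmf (\<pi>ref x) y) + U x y / \<beta>))"
      by simp
    then show ?thesis
      using pos by (simp add: exp_add)
  next
    case False
    then have "y \<notin> set_pmf (\<pi> x)" using assms(2) by simp
    with False show ?thesis by (simp add: set_pmf_iff)
  qed
  then show ?thesis by (intro exI[of _ "exp k"]) simp
qed

section \<open>The regularized utility and its unique maximizer\<close>

text \<open>\<open>KL_divergence\<close> is defined through a Radon-Nikodym derivative; since
  \<open>r\<close> is positive on \<open>A\<close>, the quotient of the mass functions is a density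
  of \<open>q\<close> with respect to \<open>r\<close>.\<close>

lemma KL_divergence_pmf:
  assumes "finite A" "set_pmf r = A" "set_pmf q \<subseteq> A"
  shows "KL_divergence (exp 1) (measure_pmf r) (measure_pmf q) =
    (\<Sum>y\<in>A. pmf q y * ln (pmf q y / pmf r y))"
proof -
  let ?f = "\<lambda>y. pmf q y / pmf r y"
  have rpos: "pmf r y > 0" if "y \<in> A" for y
    using that assms(2) by (simp add: pmf_positive)
  have "measure_pmf q = density (measure_pmf r) (\<lambda>y. ennreal (?f y))"
  proof (rule measure_eqI)
    fix B
    have "emeasure (density (measure_pmf r) (\<lambda>y. ennreal (?f y))) B =
        (\<integral>\<^sup>+ y. ennreal (?f y) * indicator B y \<partial>measure_pmf r)"
      by (simp add: emeasure_density)
    also have "\<dots> = (\<Sum>y\<in>A. ennreal (?f y) * indicator B y * ennreal (pmf r y))"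
      using assms(1,2) by (simp add: nn_integral_measure_pmf_finite)
    also have "\<dots> = (\<Sum>y\<in>A. indicator B y * ennreal (pmf q y))"
      using rpos
      by (intro sum.cong refl)
        (auto split: split_indicator simp: ennreal_mult[symmetric] less_imp_neq[THEN not_sym])
    also have "\<dots> = (\<Sum>y\<in>set_pmf q. indicator B y * ennreal (pmf q y))"
      using assms by (intro sum.mono_neutral_right) (auto simp: set_pmf_iff)
    also have "\<dots> = (\<integral>\<^sup>+ y. indicator B y \<partial>measure_pmf q)"
      using finite_subset[OF assms(3,1)] by (intro nn_integral_measure_pmf_finite[symmetric]) simp_all
    also have "\<dots> = emeasure (measure_pmf q) B"
      by simp
    finally show "emeasure (measure_pmf q) B =
        emeasure (density (measure_pmf r) (\<lambda>y. ennreal (?f y))) B"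
      by simp
  qed simp
  then have "KL_divergence (exp 1) (measure_pmf r) (measure_pmf q) =
      (\<integral>y. ?f y * log (exp 1) (?f y) \<partial>measure_pmf r)"
    using sigma_finite_measure.KL_density[OF measure_pmf.sigma_finite_measure_axioms,
        where f = ?f and b = "exp 1"] by simp
  also have "\<dots> = (\<Sum>y\<in>A. ?f y * log (exp 1) (?f y) * pmf r y)"
    using assms(1,2) by (intro integral_measure_pmf_real) auto
  also have "\<dots> = (\<Sum>y\<in>A. pmf q y * ln (?f y))"
    using rpos by (intro sum.cong refl) (auto simp: log_def less_imp_neq[THEN not_sym])
  finally show ?thesis .
qed

text \<open>Gibbs variational principle: \<open>U x y\<close> equals
  \<open>\<beta> * ln (pmf p y / pmf (\<pi>ref x) y) - \<beta> * ln c\<close> on \<open>A\<close>,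
  which merges with the divergence from the reference into the divergence from \<open>p\<close>. The
  constant \<open>- \<beta> * ln c\<close> is \<open>\<beta>\<close> times the log-partition
  function.\<close>

lemma regularized_utility_gibbs:
  assumes "\<beta> > 0" "c > 0" "\<And>y. pmf p y = c * (pmf (\<pi>ref x) y * exp (U x y / \<beta>))"
    and "finite A" "set_pmf (\<pi>ref x) = A" "set_pmf q \<subseteq> A"
  shows "regularized_utility \<beta> \<pi>ref U x q =
    - \<beta> * ln c - \<beta> * (\<Sum>y\<in>A. pmf q y * ln (pmf q y / pmf p y))"
proof -
  have summand: "pmf q y * U x y - \<beta> * (pmf q y * ln (pmf q y / pmf (\<pi>ref x) y)) =
      - \<beta> * ln c * pmf q y - \<beta> * (pmf q y * ln (pmf q y / pmf p y))" if "y \<in> A" for y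
  \<comment> \<open>The logarithm laws need positive arguments; where \<open>q\<close> vanishes, the
    factor \<open>pmf q y\<close> makes both sides 0.\<close>
  proof (cases "pmf q y = 0")
    case False
    then have q: "pmf q y > 0" by (simp add: less_le)
    have r: "pmf (\<pi>ref x) y > 0" using that assms(5) by (simp add: pmf_positive)
    show ?thesis
      using q r assms(1,2) by (simp add: assms(3) ln_div ln_mult field_simps)
  qed simp
  have "regularized_utility \<beta> \<pi>ref U x q =
      (\<Sum>y\<in>A. U x y * pmf q y) - \<beta> * (\<Sum>y\<in>A. pmf q y * ln (pmf q y / pmf (\<pi>ref x) y))"
    unfolding regularized_utility_def KL_divergence_pmf[OF assms(4-6)]
    using assms(4,6) by (subst integral_measure_pmf_real[of A]) auto
  also have "\<dots> = (\<Sum>y\<in>A. - \<beta> * ln c * pmf q y - \<beta> * (pmf q y * ln (pmf q y / pmf p y)))"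
    using summand by (simp add: sum_distrib_left sum_subtractf[symmetric] mult.commute cong: sum.cong)
  also have "\<dots> = - \<beta> * ln c * sum (pmf q) A - \<beta> * (\<Sum>y\<in>A. pmf q y * ln (pmf q y / pmf p y))"
    by (simp add: sum_distrib_left sum_subtractf)
  also have "sum (pmf q) A = 1"
    using assms(4,6) by (rule sum_pmf_eq_1)
  finally show ?thesis by simp
qed

lemma entropy_regularized_optimal_gibbs:
  assumes "\<beta> > 0" "c > 0" "\<And>y. pmf p y = c * (pmf (\<pi>ref x) y * exp (U x y / \<beta>))"
    and "finite (Y x)" "set_pmf (\<pi>ref x) = Y x"
  shows "entropy_regularized_optimal \<beta> \<pi>ref U Y x q \<longleftrightarrow> q = p"
proof -
  let ?R = "regularized_utility \<beta> \<pi>ref U x"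
  let ?kl = "\<lambda>q. \<Sum>y\<in>Y x. pmf q y * ln (pmf q y / pmf p y)"
  have setp: "set_pmf p = Y x"
    using set_pmf_proportional[OF assms(2,3)] assms(5) by simp
  have R: "?R q = - \<beta> * ln c - \<beta> * ?kl q" if "set_pmf q \<subseteq> Y x" for q
    using regularized_utility_gibbs[where \<beta>=\<beta> and \<pi>ref=\<pi>ref and U=U and x=x, OF assms that] .
  have ppos: "pmf p y > 0" if "y \<in> Y x" for y
    using that setp by (simp add: pmf_positive)
  have total: "sum (pmf q) (Y x) = sum (pmf p) (Y x)" if "set_pmf q \<subseteq> Y x" for q
    using sum_pmf_eq_1[OF assms(4)] that setp by simp
  have Rp: "?R p = - \<beta> * ln c"
  proof -
    have "?kl p = 0"
      by (intro sum.neutral ballI) (use ppos in \<open>simp add: less_imp_neq[THEN not_sym]\<close>)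
    then show ?thesis using R[of p] setp by simp
  qed
  have le: "?R q \<le> ?R p" if "set_pmf q \<subseteq> Y x" for q
    using gibbs_inequality(1)[OF assms(4) pmf_nonneg ppos total[OF that]] assms(1) R[OF that] Rp
    by simp
  have eq: "q = p" if "set_pmf q \<subseteq> Y x" "?R q = ?R p" for q
  proof (rule pmf_eqI)
    fix y
    have "?kl q = 0"
      using R[OF that(1)] that(2) Rp assms(1) by simp
    then have "pmf q y = pmf p y" if "y \<in> Y x"
      using gibbs_inequality(2)[OF assms(4) pmf_nonneg ppos total[OF \<open>set_pmf q \<subseteq> Y x\<close>]] that
      by blast
    moreover have "pmf q y = 0" "pmf p y = 0" if "y \<notin> Y x"
      using that \<open>set_pmf q \<subseteq> Y x\<close> setp by (metis pmf_eq_0_set_pmf subsetD)+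
    ultimately show "pmf q y = pmf p y"
      by fastforce
  qed
  show ?thesis
    unfolding entropy_regularized_optimal_def is_arg_max_def
    using le eq setp by (metis not_less order.antisym order_refl)
qed

section \<open>Existence and identification of the DPO minimizers\<close>

theorem corollary3p5:
  fixes X :: "'x set" and Y :: "'x \<Rightarrow> 'y set"
    and U :: "'x \<Rightarrow> 'y \<Rightarrow> real" and \<beta> :: real
    and \<pi>ref :: "'x \<Rightarrow> 'y pmf"
    and D :: "('x \<times> 'y \<times> 'y) pmf" and P :: "'x \<Rightarrow> 'y \<Rightarrow> 'y \<Rightarrow> real"
  assumes beta_pos: "\<beta> > 0"
    and finite_chains: "\<And>x. x \<in> X \<Longrightarrow> finite (Y x)"
    and ref_positive: "positive_policy X Y \<pi>ref"
    and compared_chains: "\<And>x a b. (x, a, b) \<in> set_pmf D \<Longrightarrow> x \<in> X \<and> a \<in> Y x \<and> b \<in> Y x"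
    and coverage: "\<And>x a b. x \<in> X \<Longrightarrow> a \<in> Y x \<Longrightarrow> b \<in> Y x \<Longrightarrow> (a, b) \<in> (compared D x)\<^sup>*"
    and bradley_terry: "\<And>x a b. x \<in> X \<Longrightarrow> a \<in> Y x \<Longrightarrow> b \<in> Y x \<Longrightarrow>
           P x a b = sigmoid (U x a - U x b)"
  shows "(\<exists>\<pi>. dpo_optimal \<beta> \<pi>ref D P X Y \<pi>) \<and>
    (\<forall>\<pi>. dpo_optimal \<beta> \<pi>ref D P X Y \<pi> \<longrightarrow>
      (\<forall>x\<in>X.
        (\<exists>c>0. \<forall>y. pmf (\<pi> x) y = c * (pmf (\<pi>ref x) y * exp (U x y / \<beta>))) \<and>
        (\<forall>p. entropy_regularized_optimal \<beta> \<pi>ref U Y x p \<longleftrightarrow> p = \<pi> x)))"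
proof -
  let ?t = "\<lambda>\<pi> x a b. implicit_reward \<beta> \<pi>ref \<pi> x a - implicit_reward \<beta> \<pi>ref \<pi> x b"
  let ?loss = "\<lambda>\<pi> (x, a, b). ennreal (bernoulli_loss (U x a - U x b) (?t \<pi> x a b))"
  have set_ref: "set_pmf (\<pi>ref x) = Y x" if "x \<in> X" for x
    using ref_positive that by (simp add: positive_policy_def)
  have objective: "dpo_objective \<beta> \<pi>ref D P \<pi> = (\<integral>\<^sup>+ z. ?loss \<pi> z \<partial>measure_pmf D)" for \<pi>
    by (intro dpo_objective_bradley_terry bradley_terry) (use compared_chains in auto)

  \<comment> \<open>Placing the condition \<open>x \<in> X\<close> under the quantifier lets one
    choice yield a total policy, arbitrary outside \<open>X\<close>.\<close>
  have "\<exists>p. x \<in> X \<longrightarrow>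
      (\<exists>c>0. \<forall>y. pmf p y = c * (pmf (\<pi>ref x) y * exp (U x y / \<beta>)))" for x
  proof (cases "x \<in> X")
    case True
    show ?thesis
    proof (rule exists_pmf_proportional[of "Y x" "\<lambda>y. pmf (\<pi>ref x) y * exp (U x y / \<beta>)"])
      show "finite (Y x)" using True by (rule finite_chains)
      show "Y x \<noteq> {}" using set_ref[OF True] set_pmf_not_empty[of "\<pi>ref x"] by simp
    qed (use set_ref[OF True] in \<open>auto simp: pmf_positive set_pmf_iff\<close>)
  qed simp
  then obtain \<pi>s where gibbs: "\<And>x. x \<in> X \<Longrightarrow>
      \<exists>c>0. \<forall>y. pmf (\<pi>s x) y = c * (pmf (\<pi>ref x) y * exp (U x y / \<beta>))"
    by metis
  have pos: "positive_policy X Y \<pi>s"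
    unfolding positive_policy_def
  proof
    fix x assume x: "x \<in> X"
    then obtain c where "c > 0" "\<And>y. pmf (\<pi>s x) y = c * (pmf (\<pi>ref x) y * exp (U x y / \<beta>))"
      using gibbs by auto
    then show "set_pmf (\<pi>s x) = Y x"
      using set_pmf_proportional[of c "\<pi>s x" "\<pi>ref x" "\<lambda>y. U x y / \<beta>"] set_ref[OF x] by simp
  qed
  have t_gibbs: "?t \<pi>s x a b = U x a - U x b" if "(x, a, b) \<in> set_pmf D" for x a b
  proof -
    have x: "x \<in> X" "a \<in> Y x" "b \<in> Y x" using compared_chains[OF that] by auto
    obtain c where "c > 0" "\<And>y. pmf (\<pi>s x) y = c * (pmf (\<pi>ref x) y * exp (U x y / \<beta>))"
      using gibbs[OF x(1)] by auto
    note reward = implicit_reward_gibbs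
      [where U = U and \<pi> = \<pi>s and x = x and \<pi>ref = \<pi>ref, OF beta_pos this]
    show ?thesis using x set_ref by (simp add: reward)
  qed
  \<comment> \<open>The Gibbs policy minimizes the loss of every comparison separately, not merely
    the average.\<close>
  have le: "AE z in measure_pmf D. ?loss \<pi>s z \<le> ?loss \<pi> z" for \<pi>
    by (intro AE_pmfI) (auto simp: t_gibbs bernoulli_loss_minimal(1) intro!: ennreal_leI)
  have minimal: "dpo_objective \<beta> \<pi>ref D P \<pi>s \<le> dpo_objective \<beta> \<pi>ref D P \<pi>" for \<pi>
    unfolding objective using le by (rule nn_integral_mono_AE)
  \<comment> \<open>Only with a finite minimum do equal integrals force equal integrands almost
    everywhere.\<close>
  have finite_objective: "(\<integral>\<^sup>+ z. ?loss \<pi>s z \<partial>measure_pmf D) \<noteq> \<infinity>"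
  proof -
    have "(\<integral>\<^sup>+ z. ?loss \<pi>s z \<partial>measure_pmf D) \<le> (\<integral>\<^sup>+ z. ennreal (ln 2) \<partial>measure_pmf D)"
      by (intro nn_integral_mono_AE AE_pmfI)
        (auto simp: t_gibbs bernoulli_loss_bounded intro!: ennreal_leI)
    also have "\<dots> = ennreal (ln 2)"
      by simp
    finally show ?thesis by (auto simp: top_unique)
  qed
  have "dpo_optimal \<beta> \<pi>ref D P X Y \<pi>s"
    unfolding dpo_optimal_def is_arg_min_def using pos minimal by (simp add: not_less)
  moreover have "\<exists>c>0. \<forall>y. pmf (\<pi> x) y = c * (pmf (\<pi>ref x) y * exp (U x y / \<beta>))"
    if opt: "dpo_optimal \<beta> \<pi>ref D P X Y \<pi>" and x: "x \<in> X" for \<pi> x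
  proof (rule gibbs_of_implicit_reward[OF beta_pos])
    have pi: "positive_policy X Y \<pi>"
      and "\<not> dpo_objective \<beta> \<pi>ref D P \<pi>s < dpo_objective \<beta> \<pi>ref D P \<pi>"
      using opt pos by (auto simp: dpo_optimal_def is_arg_min_def)
    \<comment> \<open>Otherwise \<open>le\<close> would be strict on a set of positive measure, and
      \<open>\<pi>s\<close> would have a strictly smaller objective than
      \<open>\<pi>\<close>.\<close>
    then have "AE z in measure_pmf D. ?loss \<pi> z \<le> ?loss \<pi>s z"
      using nn_integral_less[of "?loss \<pi>s" "measure_pmf D" "?loss \<pi>", OF _ _ finite_objective le]
      unfolding objective by auto
    \<comment> \<open>Every point of the support is an atom, so almost everywhere means everywhere
      on the support.\<close>
    then have "?loss \<pi> z \<le> ?loss \<pi>s z" if "z \<in> set_pmf D" for z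
      using that by (simp add: AE_measure_pmf_iff)
    then have pair: "?t \<pi> x a b = U x a - U x b" if "(x, a, b) \<in> set_pmf D" for a b
      using that t_gibbs[OF that] bernoulli_loss_minimal[of "U x a - U x b" "?t \<pi> x a b"]
      by (force simp: ennreal_le_iff bernoulli_loss_nonneg)
    show "set_pmf (\<pi> x) = set_pmf (\<pi>ref x)"
      using pi x set_ref by (simp add: positive_policy_def)
    fix a b assume "a \<in> set_pmf (\<pi>ref x)" "b \<in> set_pmf (\<pi>ref x)"
    then have "(a, b) \<in> (compared D x)\<^sup>*"
      using coverage x set_ref by simp
    \<comment> \<open>Both differences telescope along a path of comparisons. An edge may come from
      a triple in either order; reversing it negates both sides.\<close>
    then show "?t \<pi> x a b = U x a - U x b"
    proof (induction rule: rtrancl_induct)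
      case (step b b')
      then have "?t \<pi> x b b' = U x b - U x b'"
        using pair[of b b'] pair[of b' b] by (auto simp: compared_def)
      with step show ?case by simp
    qed simp
  qed
  ultimately show ?thesis
    using entropy_regularized_optimal_gibbs[OF beta_pos] finite_chains set_ref by (metis (no_types))
qed

end
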